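(* Let $d\ge2$, let $X$ be a (one-sided) shift space over a finite alphabet, let $m\in\mathbb{N}$, and let $X^{[m]}$ be the $m$th higher block shift of $X$. Then the hom tree-shifts on the $d$-tree corresponding to $X$ and $X^{[m]}$ satisfy $h(\mathcal{T}_X)=h(\mathcal{T}_{X^{[m]}})$.
   Context: $\mathbb{N}=\{1,2,\dots\}$. A shift space over a finite alphabet $\mathcal{A}$ is a set $X\subseteq\mathcal{A}^{\mathbb{N}}$ consisting of all sequences that avoid every word from some set $\mathcal{F}$ of finite words over $\mathcal{A}$. $\mathcal{A}(X)$ denotes the alphabet of $X$. For $n\in\mathbb{N}$, the $n$th higher block shift of $X$ is $$X^{[n]}=\{(y_i)_{i\in\mathbb{N}}\in(\mathcal{A}(X)^n)^{\mathbb{N}}:\ \exists x\in X \text{ such that } y_i=x_i x_{i+1}\cdots x_{i+n-1}\ \forall i\in\mathbb{N}\}.$$ Let $\Sigma=\{0,1,\dots,d-1\}$, $\Sigma^*=\bigcup_{n\ge0}\Sigma^n$ the set of all finite words over $\Sigma$ (with empty word $\epsilon$), and $\Delta_n=\bigcup_{i=0}^n\Sigma^i$. A labeled tree is a function $t:\Sigma^*\to\mathcal{A}$, $w\mapsto t_w$. An $n$-block is a function $u:\Delta_n\to\mathcal{A}$; it appears in $t$ if there is $s\in\Sigma^*$ with $t_{sw}=u_w$ for all $w\in\Delta_n$. A chain is a sequence $\mathbf{s}=(s_i)_{i\in\mathbb{N}}$ in $\Sigma^*$ with $s_1=\epsilon$ and $s_{i+1}\in s_i\Sigma$ for all $i\ge1$;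 put $(\pi_{\mathbf{s}}t)_i=t_{s_i}$. The hom tree-shift of a shift space $X\subseteq\mathcal{A}^{\mathbb{N}}$ is $\mathcal{T}_X=\{t\in\mathcal{A}^{\Sigma^*}:\pi_{\mathbf{s}}(t)\in X\text{ for every chain }\mathbf{s}\}$. $B_n(\mathcal{T}_X)$ is the set of $n$-blocks appearing in elements of $\mathcal{T}_X$, and the topological entropy is $h(\mathcal{T}_X)=\lim_{n\to\infty}\frac{\log|B_n(\mathcal{T}_X)|}{|\Delta_n|}$ (the limit is known to exist). *)

theory Defs
  imports Complex_Main "HOL-Library.FuncSet"
begin

(* One-sided sequences are functions on nat, so the position i >= 1 of the usual
   indexing by {1,2,...} is position i - 1 here. *)

definition occurs_in :: "'a list \<Rightarrow> (nat \<Rightarrow> 'a) \<Rightarrow> bool" where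
  "occurs_in w x \<longleftrightarrow> (\<exists>i. \<forall>j<length w. x (i + j) = w ! j)"

definition shift_space :: "'a set \<Rightarrow> (nat \<Rightarrow> 'a) set \<Rightarrow> bool" where
  "shift_space A X \<longleftrightarrow> finite A \<and>
     (\<exists>F \<subseteq> lists A. X = {x. (\<forall>i. x i \<in> A) \<and> (\<forall>w\<in>F. \<not> occurs_in w x)})"

(* The symbols that actually occur in X; the ambient alphabet may be larger. *)
definition alphabet :: "(nat \<Rightarrow> 'a) set \<Rightarrow> 'a set" where
  "alphabet X = {x i | x i. x \<in> X}"

definition words_of_length :: "'a set \<Rightarrow> nat \<Rightarrow> 'a list set" where
  "words_of_length A n = {w \<in> lists A. length w = n}"

definition higher_block_shift :: "nat \<Rightarrow> (nat \<Rightarrow> 'a) set \<Rightarrow> (nat \<Rightarrow> 'a list) set" where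
  "higher_block_shift n X =
     {y. (\<forall>i. y i \<in> words_of_length (alphabet X) n) \<and>
         (\<exists>x\<in>X. \<forall>i. y i = map x [i..<i + n])}"

definition nodes :: "nat \<Rightarrow> nat list set" where
  "nodes d = lists {..<d}"

definition Delta :: "nat \<Rightarrow> nat \<Rightarrow> nat list set" where
  "Delta d n = (\<Union>i\<le>n. words_of_length {..<d} i)"

(* Labeled trees and blocks are extensional functions (undefined outside their domain),
   so that each of them is represented exactly once and blocks can be counted. *)

definition labeled_trees :: "nat \<Rightarrow> 'a set \<Rightarrow> (nat list \<Rightarrow> 'a) set" where
  "labeled_trees d A = nodes d \<rightarrow>\<^sub>E A"

definition blocks :: "nat \<Rightarrow> nat \<Rightarrow> 'a set \<Rightarrow> (nat list \<Rightarrow> 'a) set" where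
  "blocks d n A = Delta d n \<rightarrow>\<^sub>E A"

definition appears_in ::
    "nat \<Rightarrow> nat \<Rightarrow> (nat list \<Rightarrow> 'a) \<Rightarrow> (nat list \<Rightarrow> 'a) \<Rightarrow> bool" where
  "appears_in d n u t \<longleftrightarrow> (\<exists>s\<in>nodes d. \<forall>w\<in>Delta d n. t (s @ w) = u w)"

definition chain :: "nat \<Rightarrow> (nat \<Rightarrow> nat list) \<Rightarrow> bool" where
  "chain d s \<longleftrightarrow> s 0 = [] \<and> (\<forall>i. \<exists>a<d. s (Suc i) = s i @ [a])"

definition hom_tree_shift ::
    "nat \<Rightarrow> 'a set \<Rightarrow> (nat \<Rightarrow> 'a) set \<Rightarrow> (nat list \<Rightarrow> 'a) set" where
  "hom_tree_shift d A X =
     {t \<in> labeled_trees d A. \<forall>s. chain d s \<longrightarrow> (\<lambda>i. t (s i)) \<in> X}"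

definition blocks_of ::
    "nat \<Rightarrow> 'a set \<Rightarrow> (nat list \<Rightarrow> 'a) set \<Rightarrow> nat \<Rightarrow> (nat list \<Rightarrow> 'a) set" where
  "blocks_of d A T n = {u \<in> blocks d n A. \<exists>t\<in>T. appears_in d n u t}"

(* For T = {} every block set is empty and the entropy is 0, because ln 0 = 0 in HOL. *)
definition tree_entropy :: "nat \<Rightarrow> 'a set \<Rightarrow> (nat list \<Rightarrow> 'a) set \<Rightarrow> real" where
  "tree_entropy d A T =
     lim (\<lambda>n. ln (real (card (blocks_of d A T n))) / real (card (Delta d n)))"

end

theory Submission
  imports Defs
begin

text \<open>
  Write \<open>k = m - 1\<close>. In a tree \<open>y\<close> of the hom tree-shift of the higher block shift, the label of
  a child is the label of its parent with the first letter dropped and one new letter appended. Hence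
  \<open>y\<close> carries the same information as the tree of last letters, which lies in the hom tree-shift
  of \<open>X\<close>, together with the \<open>k\<close> letters that precede its root. Two injections make this
  quantitative.

  \<^item> An \<open>n\<close>-block of \<open>y\<close> is determined by its root label and by its last letters
    (lemma \<open>card_higher_blocks_le\<close>). So passing to the higher block shift increases the number of
    \<open>n\<close>-blocks by at most a factor that does not depend on \<open>n\<close>.
  \<^item> Conversely, in a tree \<open>t\<close> over \<open>X\<close> let a node at depth at least \<open>k\<close> read the last
    \<open>m\<close> letters on the path that ends there. Below each of the \<open>d ^ k\<close> nodes of depth \<open>k\<close> this gives a tree
    over the higher block shift, and these trees together recover all of \<open>t\<close> (lemma
    \<open>card_blocks_le_power\<close>). So the number of \<open>(n + k)\<close>-blocks over \<open>X\<close> is at most the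
    \<open>(d ^ k)\<close>-th power of the number of \<open>n\<close>-blocks over the higher block shift. The exponent is
    harmless because \<open>\<Delta>\<close> grows by at least the same factor:
    \<open>d ^ k * |\<Delta> n| \<le> |\<Delta> (n + k)|\<close>.

  With \<open>a n\<close> and \<open>b n\<close> the normalised logarithms for \<open>X\<close> and for its higher block shift, this
  says \<open>a (n + k) \<le> b n \<le> a n + c / |\<Delta> n|\<close> with \<open>c\<close> independent of \<open>n\<close>. Such a
  two-sided comparison forces the two sequences to have the same limits
  (lemma \<open>LIMSEQ_iff_of_shifted_sandwich\<close>).
\<close>

section \<open>Words and finite trees\<close>

lemma finite_words_of_length: "finite A \<Longrightarrow> finite (words_of_length A n)"
  using finite_lists_length_eq[of A n] by (simp add: words_of_length_def lists_eq_set)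

lemma card_words_of_length: "finite A \<Longrightarrow> card (words_of_length A n) = card A ^ n"
  using card_lists_length_eq[of A n] by (simp add: words_of_length_def lists_eq_set)

lemma Delta_iff: "w \<in> Delta d n \<longleftrightarrow> w \<in> nodes d \<and> length w \<le> n"
  by (auto simp: Delta_def words_of_length_def nodes_def)

lemma nodes_append [simp]: "v @ w \<in> nodes d \<longleftrightarrow> v \<in> nodes d \<and> w \<in> nodes d"
  by (simp add: nodes_def)

lemma Nil_in_nodes [simp]: "[] \<in> nodes d"
  by (simp add: nodes_def)

lemma replicate_in_nodes: "d \<ge> 1 \<Longrightarrow> replicate n 0 \<in> nodes d"
  by (auto simp: nodes_def in_lists_conv_set)

lemma take_in_nodes: "w \<in> nodes d \<Longrightarrow> take n w \<in> nodes d"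
  and drop_in_nodes: "w \<in> nodes d \<Longrightarrow> drop n w \<in> nodes d"
  by (auto simp: nodes_def in_lists_conv_set dest: in_set_takeD in_set_dropD)

lemma words_iff_nodes: "w \<in> words_of_length {..<d} n \<longleftrightarrow> w \<in> nodes d \<and> length w = n"
  by (auto simp: words_of_length_def nodes_def)

lemma finite_Delta: "finite (Delta d n)"
  by (simp add: Delta_def finite_words_of_length)

lemma card_Delta_pos: "0 < card (Delta d n)"
proof -
  have "[] \<in> Delta d n"
    by (simp add: Delta_iff)
  then show ?thesis
    using finite_Delta[of d n] card_gt_0_iff by blast
qed

lemma le_card_Delta:
  assumes "d \<ge> 1"
  shows "n \<le> card (Delta d n)"
proof -
  have "card ((\<lambda>i. replicate i (0::nat)) ` {..n}) \<le> card (Delta d n)"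
    using assms by (intro card_mono finite_Delta) (auto simp: Delta_iff replicate_in_nodes)
  moreover have "inj_on (\<lambda>i. replicate i (0::nat)) {..n}"
    by (rule inj_onI) (metis length_replicate)
  ultimately show ?thesis
    by (simp add: card_image)
qed

lemma power_mult_card_Delta_le: "d ^ k * card (Delta d n) \<le> card (Delta d (n + k))"
proof -
  let ?P = "words_of_length {..<d} k \<times> Delta d n"
  have "inj_on (\<lambda>(v, w). v @ w) ?P"
    by (auto intro!: inj_onI simp: words_iff_nodes)
  moreover have "(\<lambda>(v, w). v @ w) ` ?P \<subseteq> Delta d (n + k)"
    by (auto simp: words_iff_nodes Delta_iff)
  ultimately have "card ?P \<le> card (Delta d (n + k))"
    by (meson card_inj_on_le finite_Delta)
  then show ?thesis
    by (simp add: card_cartesian_product card_words_of_length)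
qed

section \<open>Chains\<close>

lemma chain_length: "chain d s \<Longrightarrow> length (s i) = i"
proof (induction i)
  case (Suc i)
  then show ?case by (metis chain_def length_append_singleton)
qed (simp add: chain_def)

lemma chain_in_nodes: "chain d s \<Longrightarrow> s i \<in> nodes d"
proof (induction i)
  case (Suc i)
  then obtain a where "a < d" "s (Suc i) = s i @ [a]"
    by (auto simp: chain_def)
  with Suc show ?case by (simp add: nodes_def)
qed (simp add: chain_def)

lemma chain_take:
  assumes "chain d s" and "i \<le> j"
  shows "take i (s j) = s i"
  using assms(2)
proof (induction j rule: dec_induct)
  case base
  then show ?case using chain_length[OF assms(1), of i] by simp
next
  case (step j)
  obtain a where "s (Suc j) = s j @ [a]"
    using assms(1) by (auto simp: chain_def)
  with step show ?case
    using chain_length[OF assms(1), of j] by simp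
qed

text \<open>
  A chain is the sequence of prefixes of an infinite path. Here the path is given by words that may
  run ahead of the position and need to agree only up to it.
\<close>

lemma chain_prefixes:
  assumes "\<And>i. p i \<in> nodes d" and "\<And>i. i \<le> length (p i)"
    and "\<And>i. take i (p (Suc i)) = take i (p i)"
  shows "chain d (\<lambda>i. take i (p i))"
  unfolding chain_def
proof (intro conjI allI)
  fix i
  have less: "i < length (p (Suc i))"
    using assms(2)[of "Suc i"] by simp
  then have "take (Suc i) (p (Suc i)) = take i (p i) @ [p (Suc i) ! i]"
    by (simp add: take_Suc_conv_app_nth assms(3))
  moreover have "p (Suc i) ! i < d"
    using assms(1)[of "Suc i"] less by (auto simp: nodes_def in_lists_conv_set)
  ultimately show "\<exists>a<d. take (Suc i) (p (Suc i)) = take i (p i) @ [a]"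
    by blast
qed simp

lemma chain_through_node:
  assumes "d \<ge> 1" and "w \<in> nodes d"
  obtains s where "chain d s" and "\<And>i. i \<le> length w \<Longrightarrow> s i = take i w"
proof
  show "chain d (\<lambda>i. take i (w @ replicate i 0))"
    using assms by (intro chain_prefixes)
      (auto simp: replicate_in_nodes min_def simp del: replicate_Suc)
qed simp

lemma chain_append:
  assumes "chain d c" and "p \<in> nodes d"
  shows "chain d (\<lambda>i. take i (p @ c i))"
proof (rule chain_prefixes)
  fix i
  show "p @ c i \<in> nodes d" "i \<le> length (p @ c i)"
    using assms chain_in_nodes chain_length by (auto simp: chain_length[OF assms(1)])
  have "take (i - length p) (c (Suc i)) = take (i - length p) (c i)"
    using chain_take[OF assms(1), of "i - length p"] by simp
  then show "take i (p @ c (Suc i)) = take i (p @ c i)"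
    by simp
qed

section \<open>Shift spaces and their blocks\<close>

lemma shift_space_shift:
  assumes "shift_space A X" and "x \<in> X"
  shows "(\<lambda>i. x (k + i)) \<in> X"
proof -
  obtain F where X: "X = {x. (\<forall>i. x i \<in> A) \<and> (\<forall>w\<in>F. \<not> occurs_in w x)}"
    using assms(1) by (auto simp: shift_space_def)
  have "occurs_in w x" if "occurs_in w (\<lambda>i. x (k + i))" for w
    using that unfolding occurs_in_def by (metis add.assoc)
  with assms(2) show ?thesis
    unfolding X by auto
qed

lemma alphabet_subset: "shift_space A X \<Longrightarrow> alphabet X \<subseteq> A"
  by (auto simp: shift_space_def alphabet_def)

lemma alphabetI: "x \<in> X \<Longrightarrow> x i \<in> alphabet X"
  unfolding alphabet_def by (intro CollectI exI[of _ x] exI[of _ i]) simp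

lemma hom_tree_shiftI:
  assumes "t \<in> labeled_trees d A" and "\<And>s. chain d s \<Longrightarrow> (\<lambda>i. t (s i)) \<in> X"
  shows "t \<in> hom_tree_shift d A X"
  using assms by (simp add: hom_tree_shift_def)

lemma hom_tree_shiftD:
  assumes "t \<in> hom_tree_shift d A X" and "chain d s"
  shows "(\<lambda>i. t (s i)) \<in> X"
  using assms by (simp add: hom_tree_shift_def)

lemma higher_block_shift_label:
  "y \<in> higher_block_shift m X \<Longrightarrow> y i \<in> words_of_length (alphabet X) m"
  by (simp add: higher_block_shift_def)

lemma higher_block_shiftI:
  assumes "x \<in> X" and "\<And>i. y i = map x [i..<i + m]"
  shows "y \<in> higher_block_shift m X"
proof -
  have "y i \<in> words_of_length (alphabet X) m" for i
    using alphabetI[OF assms(1)] by (auto simp: words_of_length_def assms(2))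
  with assms show ?thesis
    unfolding higher_block_shift_def by blast
qed

lemma finite_blocks_of: "finite A \<Longrightarrow> finite (blocks_of d A T n)"
  by (rule finite_subset[of _ "blocks d n A"])
    (auto simp: blocks_of_def blocks_def intro: finite_PiE finite_Delta)

text \<open>The overlap condition on labels, from which the tree can be rebuilt out of its last letters.\<close>

lemma higher_block_child:
  assumes d: "d \<ge> 1" and m: "m \<ge> 1"
    and y: "y \<in> hom_tree_shift d B (higher_block_shift m X)"
    and w: "w @ [a] \<in> nodes d"
  shows "y (w @ [a]) = tl (y w) @ [last (y (w @ [a]))]"
proof -
  obtain s where s: "chain d s" "\<And>i. i \<le> length (w @ [a]) \<Longrightarrow> s i = take i (w @ [a])"
    using chain_through_node[OF d w] by blast
  then have "(\<lambda>i. y (s i)) \<in> higher_block_shift m X"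
    using y by (auto simp: hom_tree_shift_def)
  then obtain x where x: "\<And>i. y (s i) = map x [i..<i + m]"
    by (auto simp: higher_block_shift_def)
  have 1: "y w = map x [length w..<length w + m]"
    and 2: "y (w @ [a]) = map x [Suc (length w)..<Suc (length w) + m]"
    using x[of "length w"] x[of "Suc (length w)"] s(2) by auto
  have "[length w..<length w + m] = length w # [Suc (length w)..<length w + m]"
    using m by (simp add: upt_conv_Cons)
  moreover have "[Suc (length w)..<Suc (length w) + m] = [Suc (length w)..<length w + m] @ [length w + m]"
    using m by simp
  ultimately show ?thesis
    unfolding 1 2 by simp
qed

text \<open>
  If the labels along a chain are the blocks of \<open>x\<close>, their last letters form \<open>x\<close> shifted by
  \<open>m - 1\<close>; this is where shift invariance of \<open>X\<close> enters.
\<close>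

lemma last_letter_tree_in_hom_tree_shift:
  assumes d: "d \<ge> 1" and m: "m \<ge> 1" and X: "shift_space A X"
    and y: "y \<in> hom_tree_shift d (words_of_length (alphabet X) m) (higher_block_shift m X)"
  shows "(\<lambda>w\<in>nodes d. last (y w)) \<in> hom_tree_shift d A X"
  unfolding hom_tree_shift_def
proof (intro CollectI conjI allI impI)
  have "last (y w) \<in> A" if "w \<in> nodes d" for w
  proof -
    have "y w \<in> words_of_length (alphabet X) m"
      using y that by (auto simp: hom_tree_shift_def labeled_trees_def)
    then have "last (y w) \<in> alphabet X"
      using m by (auto simp: words_of_length_def in_lists_conv_set intro!: last_in_set)
    then show ?thesis
      using alphabet_subset[OF X] by auto
  qed
  then show "(\<lambda>w\<in>nodes d. last (y w)) \<in> labeled_trees d A"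
    by (auto simp: labeled_trees_def)
next
  fix s assume s: "chain d s"
  then have "(\<lambda>i. y (s i)) \<in> higher_block_shift m X"
    using y by (auto simp: hom_tree_shift_def)
  then obtain x where x: "x \<in> X" "\<And>i. y (s i) = map x [i..<i + m]"
    by (auto simp: higher_block_shift_def)
  have "(\<lambda>w\<in>nodes d. last (y w)) (s i) = x (m - 1 + i)" for i
    using m chain_in_nodes[OF s, of i] by (simp add: x(2) last_map add.commute)
  then show "(\<lambda>i. (\<lambda>w\<in>nodes d. last (y w)) (s i)) \<in> X"
    using shift_space_shift[OF X x(1), of "m - 1"] by simp
qed

text \<open>
  A block over the higher block shift is recovered from its root label and its last letters by
  descending from the root with the overlap condition.
\<close>

lemma card_higher_blocks_le:
  assumes d: "d \<ge> 1" and m: "m \<ge> 1" and X: "shift_space A X"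
  defines "B \<equiv> words_of_length (alphabet X) m"
  shows "card (blocks_of d B (hom_tree_shift d B (higher_block_shift m X)) n)
    \<le> card B * card (blocks_of d A (hom_tree_shift d A X) n)"
proof -
  let ?Y = "blocks_of d B (hom_tree_shift d B (higher_block_shift m X)) n"
  let ?X = "blocks_of d A (hom_tree_shift d A X) n"
  define f where "f = (\<lambda>u. (u [] :: 'a list, \<lambda>w\<in>Delta d n. last (u w)))"
  have fin: "finite A" "finite B"
    using X alphabet_subset[OF X]
    by (auto simp: shift_space_def B_def intro!: finite_words_of_length intro: finite_subset)
  have "f ` ?Y \<subseteq> B \<times> ?X"
  proof
    fix q assume "q \<in> f ` ?Y"
    then obtain u y s where q: "q = f u" and u: "u \<in> Delta d n \<rightarrow>\<^sub>E B"
      and y: "y \<in> hom_tree_shift d B (higher_block_shift m X)"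
      and s: "s \<in> nodes d" "\<And>w. w \<in> Delta d n \<Longrightarrow> y (s @ w) = u w"
      by (auto simp: blocks_of_def blocks_def appears_in_def)
    let ?t = "\<lambda>w\<in>nodes d. last (y w)"
    have t: "?t \<in> hom_tree_shift d A X"
      using last_letter_tree_in_hom_tree_shift[OF d m X] y by (simp add: B_def)
    have eq: "?t (s @ w) = last (u w)" if "w \<in> Delta d n" for w
      using s that by (simp add: Delta_iff)
    have "last (u w) \<in> A" if "w \<in> Delta d n" for w
    proof -
      have "?t (s @ w) \<in> A"
        using t s(1) that by (auto simp: hom_tree_shift_def labeled_trees_def Delta_iff)
      then show ?thesis using eq[OF that] by simp
    qed
    then have "(\<lambda>w\<in>Delta d n. last (u w)) \<in> blocks d n A"
      by (auto simp: blocks_def)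
    moreover have "appears_in d n (\<lambda>w\<in>Delta d n. last (u w)) ?t"
      unfolding appears_in_def by (rule bexI[OF _ s(1)]) (use eq in auto)
    moreover have "u [] \<in> B"
      using u by (auto simp: Delta_iff)
    ultimately show "q \<in> B \<times> ?X"
      using t by (auto simp: q f_def blocks_of_def)
  qed
  moreover have "inj_on f ?Y"
  proof (rule inj_onI)
    fix u u' assume u: "u \<in> ?Y" and u': "u' \<in> ?Y" and eq: "f u = f u'"
    have step: "z (w @ [a]) = tl (z w) @ [last (z (w @ [a]))]"
      if "z \<in> ?Y" "w @ [a] \<in> Delta d n" for z w a
    proof -
      obtain y s where y: "y \<in> hom_tree_shift d B (higher_block_shift m X)"
        and s: "s \<in> nodes d" "\<And>w. w \<in> Delta d n \<Longrightarrow> y (s @ w) = z w"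
        using \<open>z \<in> ?Y\<close> by (auto simp: blocks_of_def appears_in_def)
      have "y ((s @ w) @ [a]) = tl (y (s @ w)) @ [last (y ((s @ w) @ [a]))]"
        using that s by (intro higher_block_child[OF d m y]) (auto simp: Delta_iff)
      then show ?thesis
        using s(2)[of w] s(2)[of "w @ [a]"] that by (simp add: Delta_iff)
    qed
    have last_eq: "last (u w) = last (u' w)" if "w \<in> Delta d n" for w
      using eq that by (auto simp: f_def dest: fun_cong[of _ _ w])
    have "u w = u' w" if "w \<in> Delta d n" for w
      using that
    proof (induction w rule: rev_induct)
      case Nil
      then show ?case using eq by (simp add: f_def)
    next
      case (snoc a w)
      then have "u w = u' w"
        by (simp add: Delta_iff)
      then show ?case
        using step[OF u snoc.prems] step[OF u' snoc.prems] last_eq[OF snoc.prems] by simp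
    qed
    then show "u = u'"
      using u u' by (auto simp: blocks_of_def blocks_def intro: PiE_ext)
  qed
  ultimately have "card ?Y \<le> card (B \<times> ?X)"
    by (intro card_inj_on_le[of f] finite_cartesian_product fin finite_blocks_of)
  then show ?thesis
    by (simp add: card_cartesian_product)
qed

text \<open>
  If \<open>v\<close> has length \<open>m - 1\<close>, the node \<open>v @ w\<close> has depth \<open>length w + (m - 1)\<close>, so these are
  the labels of the last \<open>m\<close> nodes on the path from the root to \<open>v @ w\<close>. As \<open>w\<close> varies they label
  the tree below \<open>v\<close> by overlapping words.
\<close>

definition path_word :: "nat \<Rightarrow> (nat list \<Rightarrow> 'a) \<Rightarrow> nat list \<Rightarrow> nat list \<Rightarrow> 'a list" where
  "path_word m t v w = map (\<lambda>j. t (take j (v @ w))) [length w..<length w + m]"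

lemma path_word_tree_in_hom_tree_shift:
  assumes d: "d \<ge> 1" and X: "shift_space A X"
    and t: "t \<in> hom_tree_shift d A X" and s: "s \<in> nodes d"
    and v: "v \<in> nodes d" "Suc (length v) = m"
  shows "(\<lambda>w\<in>nodes d. path_word m (\<lambda>z. t (s @ z)) v w)
    \<in> hom_tree_shift d (words_of_length (alphabet X) m) (higher_block_shift m X)"
proof -
  let ?y = "\<lambda>w\<in>nodes d. path_word m (\<lambda>z. t (s @ z)) v w"
  have chains: "(\<lambda>i. ?y (c i)) \<in> higher_block_shift m X" if c: "chain d c" for c
  proof -
    \<comment> \<open>Prolong the chain backwards to the root of \<open>t\<close>, along \<open>s\<close> and then \<open>v\<close>; the labels read off
      below \<open>s\<close> are the sequence whose \<open>m\<close>-blocks occur along \<open>c\<close>.\<close>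
    define x where "x = (\<lambda>j. t (s @ take j (v @ c (length s + j))))"
    have "chain d (\<lambda>i. take i ((s @ v) @ c i))"
      using s v c by (intro chain_append) auto
    then have "(\<lambda>i. t (take i ((s @ v) @ c i))) \<in> X"
      by (rule hom_tree_shiftD[OF t])
    from shift_space_shift[OF X this, of "length s"] have x: "x \<in> X"
      by (simp add: x_def)
    have eq: "?y (c i) = map x [i..<i + m]" for i
    proof -
      have "take j (v @ c i) = take j (v @ c (length s + j))" if "j < i + m" for j
      proof -
        have "j - length v \<le> i" and "j - length v \<le> length s + j"
          using that v(2) by linarith+
        then have "take (j - length v) (c i) = take (j - length v) (c (length s + j))"
          using chain_take[OF c] by metis
        then show ?thesis by simp
      qed
      then show ?thesis
        using chain_in_nodes[OF c, of i] chain_length[OF c, of i]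
        by (simp add: path_word_def x_def)
    qed
    show ?thesis
      using x eq by (rule higher_block_shiftI)
  qed
  have "?y w \<in> words_of_length (alphabet X) m" if w: "w \<in> nodes d" for w
  proof -
    obtain c where c: "chain d c" "\<And>i. i \<le> length w \<Longrightarrow> c i = take i w"
      using chain_through_node[OF d w] by blast
    have "?y (c (length w)) \<in> words_of_length (alphabet X) m"
      using chains[OF c(1)] by (rule higher_block_shift_label)
    then show ?thesis
      by (simp add: c(2))
  qed
  then have "?y \<in> labeled_trees d (words_of_length (alphabet X) m)"
    unfolding labeled_trees_def by (intro PiE_I) auto
  then show ?thesis
    using chains by (rule hom_tree_shiftI)
qed

text \<open>
  Every node of \<open>\<Delta> (n + k)\<close> occurs in one of the path words below the nodes of depth \<open>k\<close>: a node at
  depth at least \<open>k\<close> as an end point, a shallower one on the path to a root of these subtrees.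
\<close>

lemma card_blocks_le_power:
  fixes k :: nat
  assumes d: "d \<ge> 1" and X: "shift_space A X"
  defines "B \<equiv> words_of_length (alphabet X) (Suc k)"
  shows "card (blocks_of d A (hom_tree_shift d A X) (n + k))
    \<le> card (blocks_of d B (hom_tree_shift d B (higher_block_shift (Suc k) X)) n) ^ (d ^ k)"
proof -
  let ?X = "blocks_of d A (hom_tree_shift d A X) (n + k)"
  let ?Y = "blocks_of d B (hom_tree_shift d B (higher_block_shift (Suc k) X)) n"
  let ?V = "words_of_length {..<d} k"
  define f where "f = (\<lambda>u :: nat list \<Rightarrow> 'a. \<lambda>v\<in>?V. \<lambda>w\<in>Delta d n. path_word (Suc k) u v w)"
  have fin: "finite B"
    using X alphabet_subset[OF X]
    by (auto simp: shift_space_def B_def intro!: finite_words_of_length intro: finite_subset)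
  have "f u v \<in> ?Y" if u: "u \<in> ?X" and v: "v \<in> ?V" for u v
  proof -
    obtain t s where t: "t \<in> hom_tree_shift d A X" and s: "s \<in> nodes d"
      and eq: "\<And>w. w \<in> Delta d (n + k) \<Longrightarrow> t (s @ w) = u w"
      using u by (auto simp: blocks_of_def appears_in_def)
    let ?y = "\<lambda>w\<in>nodes d. path_word (Suc k) (\<lambda>z. t (s @ z)) v w"
    have v': "v \<in> nodes d" "length v = k"
      using v by (auto simp: words_iff_nodes)
    have y: "?y \<in> hom_tree_shift d B (higher_block_shift (Suc k) X)"
      unfolding B_def using v' by (intro path_word_tree_in_hom_tree_shift[OF d X t s]) auto
    have fy: "f u v w = ?y w" if w: "w \<in> Delta d n" for w
    proof -
      have "take j (v @ w) \<in> Delta d (n + k)" for j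
        unfolding Delta_iff using w v' by (auto simp: Delta_iff take_in_nodes)
      then show ?thesis
        using v w eq by (simp add: f_def path_word_def Delta_iff)
    qed
    have "?y w \<in> B" if "w \<in> nodes d" for w
      using y that unfolding hom_tree_shift_def labeled_trees_def by blast
    then have "f u v w \<in> B" if "w \<in> Delta d n" for w
      using fy[OF that] that by (simp add: Delta_iff)
    moreover have "f u v w = undefined" if "w \<notin> Delta d n" for w
      using v that by (simp add: f_def)
    ultimately have "f u v \<in> blocks d n B"
      unfolding blocks_def by (intro PiE_I)
    moreover have "appears_in d n (f u v) ?y"
      unfolding appears_in_def using fy by (intro bexI[of _ "[]"]) simp_all
    ultimately show ?thesis
      using y unfolding blocks_of_def by blast
  qed
  then have "f ` ?X \<subseteq> ?V \<rightarrow>\<^sub>E ?Y"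
    by (auto simp: f_def)
  moreover have "inj_on f ?X"
  proof (rule inj_onI)
    fix u u' assume u: "u \<in> ?X" and u': "u' \<in> ?X" and eq: "f u = f u'"
    have "u z = u' z" if z: "z \<in> Delta d (n + k)" for z
    proof -
      \<comment> \<open>A node \<open>z\<close> of depth less than \<open>k\<close> is prolonged by zeros to a node \<open>v\<close> of depth \<open>k\<close>,
        and its label is read off the path word at the root of the subtree below \<open>v\<close>.\<close>
      define v where "v = take k (z @ replicate k 0)"
      define w where "w = drop k z"
      have v: "v \<in> ?V"
        using z d by (auto simp: v_def words_iff_nodes Delta_iff replicate_in_nodes take_in_nodes)
      have w: "w \<in> Delta d n"
        using z by (auto simp: w_def Delta_iff drop_in_nodes)
      have len: "length w \<le> length z" "length z - length w < Suc k"
        by (auto simp: w_def)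
      have "take (length z) (v @ w) = z"
        by (cases "length z \<le> k") (auto simp: v_def w_def min_def)
      then have nth: "f g v w ! (length z - length w) = g z" for g
        using v w len by (simp add: f_def path_word_def del: upt_Suc)
      show ?thesis
        using nth[of u] nth[of u'] eq by simp
    qed
    then show "u = u'"
      using u u' by (auto simp: blocks_of_def blocks_def intro: PiE_ext)
  qed
  moreover have "finite (?V \<rightarrow>\<^sub>E ?Y)"
    by (intro finite_PiE finite_words_of_length finite_blocks_of fin) simp
  ultimately have "card ?X \<le> card (?V \<rightarrow>\<^sub>E ?Y)"
    by (intro card_inj_on_le[of f])
  then show ?thesis
    by (simp add: card_PiE finite_words_of_length card_words_of_length)
qed

section \<open>Comparison of the entropies\<close>

text \<open>
  From left to right, \<open>b\<close> is squeezed between a shift of \<open>a\<close> and a null perturbation of \<open>a\<close>. From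
  right to left, read the two inequalities as bounds on the shifted sequence \<open>a (n + k)\<close>: it lies
  between \<open>b (n + k) - e (n + k)\<close> and \<open>b n\<close>.
\<close>

lemma LIMSEQ_iff_of_shifted_sandwich:
  fixes a b e :: "nat \<Rightarrow> real"
  assumes "\<And>n. a (n + k) \<le> b n" and "\<And>n. b n \<le> a n + e n" and e: "e \<longlonglongrightarrow> 0"
  shows "a \<longlonglongrightarrow> L \<longleftrightarrow> b \<longlonglongrightarrow> L"
proof
  have ab: "\<forall>\<^sub>F n in sequentially. a (n + k) \<le> b n"
    by (rule always_eventually) (rule allI, rule assms(1))
  {
    have be: "\<forall>\<^sub>F n in sequentially. b n \<le> a n + e n"
      by (rule always_eventually) (rule allI, rule assms(2))
    assume a: "a \<longlonglongrightarrow> L"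
    have ae: "(\<lambda>n. a n + e n) \<longlonglongrightarrow> L"
      using tendsto_add[OF a e] by simp
    show "b \<longlonglongrightarrow> L"
      by (rule tendsto_sandwich[OF ab be LIMSEQ_ignore_initial_segment[OF a] ae])
  next
    have "b (n + k) - e (n + k) \<le> a (n + k)" for n
      using assms(2)[of "n + k"] by linarith
    then have ba: "\<forall>\<^sub>F n in sequentially. b (n + k) - e (n + k) \<le> a (n + k)"
      by (rule always_eventually[OF allI])
    assume b: "b \<longlonglongrightarrow> L"
    have "(\<lambda>n. b n - e n) \<longlonglongrightarrow> L"
      using tendsto_diff[OF b e] by simp
    then have "(\<lambda>n. b (n + k) - e (n + k)) \<longlonglongrightarrow> L"
      by (rule LIMSEQ_ignore_initial_segment)
    from tendsto_sandwich[OF ba ab this b] show "a \<longlonglongrightarrow> L"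
      by (rule LIMSEQ_offset)
  }
qed

theorem theorem3p1:
  fixes d m :: nat and A :: "'a set" and X :: "(nat \<Rightarrow> 'a) set"
  assumes "d \<ge> 2" and "m \<ge> 1" and "shift_space A X"
  shows "tree_entropy d A (hom_tree_shift d A X) =
         tree_entropy d (words_of_length (alphabet X) m)
           (hom_tree_shift d (words_of_length (alphabet X) m) (higher_block_shift m X))"
proof -
  obtain k where k: "m = Suc k"
    using \<open>m \<ge> 1\<close> by (cases m) auto
  have d: "d \<ge> 1"
    using \<open>d \<ge> 2\<close> by simp
  let ?B = "words_of_length (alphabet X) m"
  define D where "D n = real (card (Delta d n))" for n
  define p where "p n = card (blocks_of d A (hom_tree_shift d A X) n)" for n
  define q where "q n = card (blocks_of d ?B (hom_tree_shift d ?B (higher_block_shift m X)) n)" for n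
  define c where "c = card ?B"
  have D: "D n > 0" for n
    using card_Delta_pos by (simp add: D_def)
  have ln_nat: "0 \<le> ln (real i)" for i
    by (cases i) auto
  have lower: "ln (p (n + k)) / D (n + k) \<le> ln (q n) / D n" for n
  proof -
    have pq: "p (n + k) \<le> q n ^ (d ^ k)"
      using card_blocks_le_power[OF d assms(3), of n k] by (simp add: p_def q_def k)
    \<comment> \<open>Without blocks the logarithm is \<open>0\<close>, which is at most the logarithm of any natural number;
      this is why empty hom tree-shifts satisfy both estimates.\<close>
    have "ln (p (n + k)) \<le> d ^ k * ln (q n)"
    proof (cases "p (n + k) = 0")
      case True
      then show ?thesis using ln_nat[of "q n"] by simp
    next
      case False
      with pq have "q n > 0"
        using d by (cases "q n = 0") (auto simp: power_0_left)
      have "ln (p (n + k)) \<le> ln (real (q n ^ (d ^ k)))"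
        using pq False by (subst ln_le_cancel_iff) (auto simp: \<open>q n > 0\<close> simp del: of_nat_power)
      also have "\<dots> = d ^ k * ln (q n)"
        using \<open>q n > 0\<close> by (simp add: ln_realpow)
      finally show ?thesis .
    qed
    also have "\<dots> \<le> D (n + k) * (ln (q n) / D n)"
    proof -
      have "d ^ k * D n \<le> D (n + k)"
        using power_mult_card_Delta_le[of d k n] unfolding D_def
        by (metis of_nat_le_iff of_nat_mult)
      then have "d ^ k * D n * (ln (q n) / D n) \<le> D (n + k) * (ln (q n) / D n)"
        using ln_nat[of "q n"] D[of n] by (intro mult_right_mono) auto
      then show ?thesis
        using D[of n] by simp
    qed
    finally show ?thesis
      using D[of "n + k"] by (simp add: pos_divide_le_eq mult.commute)
  qed
  have upper: "ln (q n) / D n \<le> ln (p n) / D n + ln c / D n" for n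
  proof -
    have qp: "q n \<le> c * p n"
      using card_higher_blocks_le[OF d assms(2,3), of n] by (simp add: p_def q_def c_def)
    have "ln (q n) \<le> ln (p n) + ln c"
    proof (cases "q n = 0")
      case True
      then show ?thesis using ln_nat[of "p n"] ln_nat[of c] by simp
    next
      case False
      with qp have pos: "c > 0" "p n > 0"
        by (auto intro!: Nat.gr0I)
      have "ln (q n) \<le> ln (real (c * p n))"
        using qp False pos by (subst ln_le_cancel_iff) (auto simp del: of_nat_mult)
      then show ?thesis
        using pos by (simp add: ln_mult)
    qed
    then show ?thesis
      using D[of n] by (simp add: divide_right_mono flip: add_divide_distrib)
  qed
  have "filterlim D at_top sequentially"
    using le_card_Delta[OF d] unfolding D_def
    by (intro filterlim_at_top_mono[OF filterlim_real_sequentially]) auto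
  then have "(\<lambda>n. ln c / D n) \<longlonglongrightarrow> 0"
    by (intro real_tendsto_divide_at_top[OF tendsto_const])
  with lower upper have "(\<lambda>n. ln (p n) / D n) \<longlonglongrightarrow> L \<longleftrightarrow> (\<lambda>n. ln (q n) / D n) \<longlonglongrightarrow> L" for L
    by (rule LIMSEQ_iff_of_shifted_sandwich)
  then show ?thesis
    by (simp add: tree_entropy_def lim_def flip: p_def q_def D_def)
qed

end
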